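(* Let $G$ be a countably infinite group and let $G\curvearrowright X$ be an expansive action on a compact metrizable space by homeomorphisms with the topological Markov property. (1) Suppose that $(x,y)\in X^2$ is an asymptotic pair with $x\neq y$ and $x\in\mathrm{IE}_1(X,G)$. Then $(x,y)\in\mathrm{IE}_2(X,G)$. In particular, $h^{\rm nv}_{\rm top}(G\curvearrowright X)>0$. (2) If $\mathrm{IE}_1(X,G)=X$ and the set $\mathtt{A}_2(X,G)$ of asymptotic pairs satisfies $\overline{\mathtt{A}_2(X,G)}=X^2$, then $G\curvearrowright X$ has naive UPE of all orders.
   Context: Fix a compatible metric $d$ on $X$ (the notions below do not depend on its choice). For $K\subset G$ and $x,y\in X$ write $d_K(x,y)=\sup_{g\in K}d(gx,gy)$. Expansive: there is $c>0$ such that for all $x\neq y$ in $X$ there is $g\in G$ with $d(gx,gy)>c$. Asymptotic pair: $(x,y)\in X^2$ such that for every $\varepsilon>0$ there is a finite $F\subset G$ with $d(gx,gy)\le\varepsilon$ for all $g\notin F$. Memory set: for $\varepsilon,\delta>0$ and finite $A\subset B\subset G$, $B$ is an $(\varepsilon,\delta)$-memory set for $A$ if for every $x,y\in X$ with $d_{B\setminus A}(x,y)\le\delta$ there is $z\in X$ with $d_B(x,z)\le\varepsilon$ and $d_{G\setminus A}(y,z)\le\varepsilon$. Topological Markov property (TMP): for every $\varepsilon>0$ there is $\delta>0$ such that every finite $A\subset G$ admits an $(\varepsilon,\delta)$-memory set. Independence: for a tuple $\mathbf A=(A_1,\dots,A_k)$ of subsets of $X$, $J\subset G$ is an independence set for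 $\mathbf A$ if for every nonempty finite $I\subset J$ and every $\phi:I\to\{1,\dots,k\}$ we have $\bigcap_{s\in I}s^{-1}A_{\phi(s)}\neq\varnothing$. The independence density of $\mathbf A$ is the largest $q\ge0$ such that every finite $F\subset G$ has a subset of cardinality at least $q|F|$ which is an independence set for $\mathbf A$. $\mathrm{IE}_k(X,G)$ ($k\ge1$) is the set of $(x_1,\dots,x_k)\in X^k$ such that for every product neighborhood $U_1\times\dots\times U_k$ of it the tuple $(U_1,\dots,U_k)$ has positive independence density. Naive UPE of all orders: $\mathrm{IE}_k(X,G)=X^k$ for all $k\ge2$. Naive topological entropy: $h^{\rm nv}_{\rm top}(G\curvearrowright X)=\sup_{\mathcal U}\inf_{\varnothing\neq F\subset G\text{ finite}}\frac1{|F|}\log N(\mathcal U^F)$, where $\mathcal U$ ranges over open covers, $\mathcal U^F=\bigvee_{g\in F}g^{-1}\mathcal U$ and $N(\cdot)$ is the minimal cardinality of a subcover. *)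

theory Defs
  imports "HOL-Analysis.Analysis" "HOL-Algebra.Group_Action" "HOL-Library.FuncSet"
begin

text \<open>
  The space is a compact set \<open>X\<close> in a metric space, the ambient \<open>dist\<close> playing the role of the
  fixed compatible metric \<open>d\<close>; the group acts through \<open>act :: 'g \<Rightarrow> 'x \<Rightarrow> 'x\<close>, which is to be
  a \<^locale>\<open>group_action\<close> of \<open>G\<close> on \<open>X\<close>. Points of the power \<open>X ^ k\<close> are lists of length \<open>k\<close>.
\<close>

definition continuous_action ::
    "('g, 'm) monoid_scheme \<Rightarrow> 'x::metric_space set \<Rightarrow> ('g \<Rightarrow> 'x \<Rightarrow> 'x) \<Rightarrow> bool" where
  "continuous_action G X act \<longleftrightarrow>
     group_action G X act \<and>
     (\<forall>g\<in>carrier G. homeomorphism X X (act g) (act (inv\<^bsub>G\<^esub> g)))"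

definition expansive ::
    "('g, 'm) monoid_scheme \<Rightarrow> 'x::metric_space set \<Rightarrow> ('g \<Rightarrow> 'x \<Rightarrow> 'x) \<Rightarrow> bool" where
  "expansive G X act \<longleftrightarrow>
     (\<exists>c>0. \<forall>x\<in>X. \<forall>y\<in>X. x \<noteq> y \<longrightarrow> (\<exists>g\<in>carrier G. dist (act g x) (act g y) > c))"

definition asymptotic_pairs ::
    "('g, 'm) monoid_scheme \<Rightarrow> 'x::metric_space set \<Rightarrow> ('g \<Rightarrow> 'x \<Rightarrow> 'x) \<Rightarrow> ('x \<times> 'x) set" where
  "asymptotic_pairs G X act =
     {(x, y). x \<in> X \<and> y \<in> X \<and>
        (\<forall>\<epsilon>>0. \<exists>F\<subseteq>carrier G. finite F \<and>
           (\<forall>g\<in>carrier G - F. dist (act g x) (act g y) \<le> \<epsilon>))}"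

text \<open>The supremum over the empty set of nonnegative numbers is \<open>0\<close>.\<close>

definition dist_on ::
    "('g \<Rightarrow> 'x::metric_space \<Rightarrow> 'x) \<Rightarrow> 'g set \<Rightarrow> 'x \<Rightarrow> 'x \<Rightarrow> real" where
  "dist_on act K x y = (if K = {} then 0 else (SUP g\<in>K. dist (act g x) (act g y)))"

text \<open>
  Both sets \<open>A \<subseteq> B\<close> are finite: \<open>B = G\<close> would be a memory set as soon as \<open>\<delta> \<le> \<epsilon>\<close>, and the
  Markov property below would hold for every action.
\<close>

definition memory_set ::
    "('g, 'm) monoid_scheme \<Rightarrow> 'x::metric_space set \<Rightarrow> ('g \<Rightarrow> 'x \<Rightarrow> 'x) \<Rightarrow>
      real \<Rightarrow> real \<Rightarrow> 'g set \<Rightarrow> 'g set \<Rightarrow> bool" where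
  "memory_set G X act \<epsilon> \<delta> A B \<longleftrightarrow>
     finite A \<and> finite B \<and> A \<subseteq> B \<and> B \<subseteq> carrier G \<and>
     (\<forall>x\<in>X. \<forall>y\<in>X. dist_on act (B - A) x y \<le> \<delta> \<longrightarrow>
        (\<exists>z\<in>X. dist_on act B x z \<le> \<epsilon> \<and> dist_on act (carrier G - A) y z \<le> \<epsilon>))"

definition topological_markov ::
    "('g, 'm) monoid_scheme \<Rightarrow> 'x::metric_space set \<Rightarrow> ('g \<Rightarrow> 'x \<Rightarrow> 'x) \<Rightarrow> bool" where
  "topological_markov G X act \<longleftrightarrow>
     (\<forall>\<epsilon>>0. \<exists>\<delta>>0. \<forall>A. finite A \<and> A \<subseteq> carrier G \<longrightarrow> (\<exists>B. memory_set G X act \<epsilon> \<delta> A B))"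

text \<open>The set \<open>g\<^sup>-\<^sup>1 A\<close> for \<open>A \<subseteq> X\<close>.\<close>

definition preimg :: "'x set \<Rightarrow> ('g \<Rightarrow> 'x \<Rightarrow> 'x) \<Rightarrow> 'g \<Rightarrow> 'x set \<Rightarrow> 'x set" where
  "preimg X act g A = {x \<in> X. act g x \<in> A}"

definition independence_set ::
    "('g, 'm) monoid_scheme \<Rightarrow> 'x set \<Rightarrow> ('g \<Rightarrow> 'x \<Rightarrow> 'x) \<Rightarrow> 'x set list \<Rightarrow> 'g set \<Rightarrow> bool" where
  "independence_set G X act As J \<longleftrightarrow>
     J \<subseteq> carrier G \<and>
     (\<forall>I \<phi>. I \<noteq> {} \<and> finite I \<and> I \<subseteq> J \<and> \<phi> \<in> I \<rightarrow> {..<length As} \<longrightarrow>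
        (\<Inter>s\<in>I. preimg X act s (As ! \<phi> s)) \<noteq> {})"

definition density_bound ::
    "('g, 'm) monoid_scheme \<Rightarrow> 'x set \<Rightarrow> ('g \<Rightarrow> 'x \<Rightarrow> 'x) \<Rightarrow> 'x set list \<Rightarrow> real \<Rightarrow> bool" where
  "density_bound G X act As q \<longleftrightarrow>
     q \<ge> 0 \<and>
     (\<forall>F. finite F \<and> F \<subseteq> carrier G \<longrightarrow>
        (\<exists>J\<subseteq>F. real (card J) \<ge> q * real (card F) \<and> independence_set G X act As J))"

definition independence_density ::
    "('g, 'm) monoid_scheme \<Rightarrow> 'x set \<Rightarrow> ('g \<Rightarrow> 'x \<Rightarrow> 'x) \<Rightarrow> 'x set list \<Rightarrow> real" where
  "independence_density G X act As = (GREATEST q. density_bound G X act As q)"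

text \<open>The greatest density bound exists.\<close>

lemma independence_density_greatest:
  assumes "carrier G \<noteq> {}"
  shows "density_bound G X act As (independence_density G X act As)"
    and "density_bound G X act As q \<Longrightarrow> q \<le> independence_density G X act As"
proof -
  let ?Q = "{q. density_bound G X act As q}"
  let ?ind = "independence_set G X act As"
  obtain a where a: "a \<in> carrier G" using assms by blast
  have zero: "0 \<in> ?Q"
    by (auto simp: density_bound_def independence_set_def intro!: exI[of _ "{}"])
  have le1: "q \<le> 1" if q: "q \<in> ?Q" for q
  proof -
    obtain J where J: "J \<subseteq> {a}" "real (card J) \<ge> q * real (card {a})"
      using q a unfolding density_bound_def by (force dest: spec[of _ "{a}"])
    moreover have "card J \<le> card {a}" using J(1) by (intro card_mono) auto
    ultimately show ?thesis by simp
  qed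
  have bdd: "bdd_above ?Q" using le1 by (rule bdd_aboveI)
  have sup: "density_bound G X act As (Sup ?Q)"
    unfolding density_bound_def[of G X act As "Sup ?Q"]
  proof (intro conjI allI impI)
    show "0 \<le> Sup ?Q" using zero bdd by (rule cSup_upper)
    fix F assume F: "finite F \<and> F \<subseteq> carrier G"
    let ?C = "card ` {J. J \<subseteq> F \<and> ?ind J}"
    have fin: "finite ?C" using F by simp
    have ne: "?C \<noteq> {}" by (auto simp: independence_set_def intro!: exI[of _ "{}"])
    obtain J where J: "J \<subseteq> F" "?ind J" "card J = Max ?C" using Max_in[OF fin ne] by auto
    have le: "q * real (card F) \<le> real (card J)" if q: "q \<in> ?Q" for q
    proof -
      obtain J' where J': "J' \<subseteq> F" "real (card J') \<ge> q * real (card F)" "?ind J'"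
        using q F unfolding density_bound_def by blast
      have "card J' \<le> card J" unfolding J(3) by (rule Max_ge[OF fin]) (use J' in auto)
      then show ?thesis using J'(2) by linarith
    qed
    have "Sup ?Q * real (card F) \<le> real (card J)"
    proof (cases "card F = 0")
      case False
      have "Sup ?Q \<le> real (card J) / real (card F)"
        by (rule cSup_least) (use zero le False in \<open>auto simp: field_simps\<close>)
      then show ?thesis using False by (simp add: field_simps)
    qed simp
    then show "\<exists>J\<subseteq>F. Sup ?Q * real (card F) \<le> real (card J) \<and> ?ind J" using J by blast
  qed
  have upper: "q \<le> Sup ?Q" if "density_bound G X act As q" for q
    using that bdd by (intro cSup_upper) auto
  have eq: "independence_density G X act As = Sup ?Q"
    unfolding independence_density_def by (rule Greatest_equality) (use sup upper in auto)
  show "density_bound G X act As (independence_density G X act As)"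
    using sup eq by simp
  show "q \<le> independence_density G X act As" if "density_bound G X act As q"
    using upper[OF that] eq by simp
qed

definition power_space :: "'x set \<Rightarrow> nat \<Rightarrow> 'x list set" where
  "power_space X k = {xs. length xs = k \<and> set xs \<subseteq> X}"

definition IE ::
    "('g, 'm) monoid_scheme \<Rightarrow> 'x::metric_space set \<Rightarrow> ('g \<Rightarrow> 'x \<Rightarrow> 'x) \<Rightarrow> nat \<Rightarrow> 'x list set" where
  "IE G X act k =
     {xs \<in> power_space X k.
        \<forall>Us. length Us = k \<and>
             (\<forall>i<k. Us ! i \<subseteq> X \<and> xs ! i \<in> top_of_set X interior_of (Us ! i)) \<longrightarrow>
             independence_density G X act Us > 0}"

definition naive_UPE_all_orders ::
    "('g, 'm) monoid_scheme \<Rightarrow> 'x::metric_space set \<Rightarrow> ('g \<Rightarrow> 'x \<Rightarrow> 'x) \<Rightarrow> bool" where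
  "naive_UPE_all_orders G X act \<longleftrightarrow> (\<forall>k\<ge>2. IE G X act k = power_space X k)"

definition open_covers :: "'x::topological_space set \<Rightarrow> 'x set set set" where
  "open_covers X = {\<U>. (\<forall>U\<in>\<U>. openin (top_of_set X) U) \<and> \<Union>\<U> = X}"

definition cover_join ::
    "'x set \<Rightarrow> ('g \<Rightarrow> 'x \<Rightarrow> 'x) \<Rightarrow> 'x set set \<Rightarrow> 'g set \<Rightarrow> 'x set set" where
  "cover_join X act \<U> F = {(\<Inter>g\<in>F. preimg X act g (c g)) | c. c \<in> F \<rightarrow> \<U>}"

text \<open>A finite subcover exists for the covers used below, since \<open>X\<close> is compact.\<close>

definition min_subcover :: "'x set \<Rightarrow> 'x set set \<Rightarrow> nat" where
  "min_subcover X \<U> = (LEAST n. \<exists>\<V>\<subseteq>\<U>. finite \<V> \<and> \<Union>\<V> = X \<and> card \<V> = n)"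

definition naive_entropy ::
    "('g, 'm) monoid_scheme \<Rightarrow> 'x::metric_space set \<Rightarrow> ('g \<Rightarrow> 'x \<Rightarrow> 'x) \<Rightarrow> ereal" where
  "naive_entropy G X act =
     (SUP \<U>\<in>open_covers X.
        INF F\<in>{F. F \<noteq> {} \<and> finite F \<and> F \<subseteq> carrier G}.
          ereal (ln (real (min_subcover X (cover_join X act \<U> F))) / real (card F)))"

end

theory Submission
  imports Defs
begin

text \<open>
  Let \<open>y\<^sub>1, \<dots>, y\<^sub>k\<close> be asymptotic to a point \<open>x\<close> of \<open>IE\<^sub>1\<close>. Independence for a small neighbourhood
  of \<open>x\<close> yields a point \<open>p\<close> whose orbit visits it along a set of positive density, which may be
  thinned out so that the visits are far apart. The Markov property then replaces, at one visit
  after the other, the orbit pattern of \<open>x\<close> by that of a prescribed \<open>y\<^sub>i\<close>. Each replacement perturbs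
  the rest of the orbit by a fixed fraction of the expansivity constant; uniform expansivity
  brings this perturbation back below any given bound before the next replacement, so that errors
  do not accumulate. Hence \<open>(y\<^sub>1, \<dots>, y\<^sub>k)\<close> lies in \<open>IE\<^sub>k\<close>.

  For the second part, the same replacement applied to a single visit shows that asymptotic
  \<open>k\<close>-tuples are dense as soon as asymptotic pairs are: if \<open>w\<close> is asymptotic to \<open>u\<^sub>1, \<dots>, u\<^sub>k\<close> and
  \<open>(w', u)\<close> is an asymptotic pair with \<open>w'\<close> close to \<open>w\<close>, then the \<open>u\<^sub>i\<close> can be perturbed to
  points asymptotic to \<open>w'\<close>.
\<close>

section \<open>Finite selection arguments\<close>

lemma uniform_radius:
  fixes P :: "'i \<Rightarrow> real \<Rightarrow> bool"
  assumes "finite I" "\<And>i. i \<in> I \<Longrightarrow> \<exists>r>0. P i r"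
    and mono: "\<And>i r r'. i \<in> I \<Longrightarrow> P i r \<Longrightarrow> 0 < r' \<Longrightarrow> r' \<le> r \<Longrightarrow> P i r'"
  shows "\<exists>r>0. \<forall>i\<in>I. P i r"
  using assms
proof (induction I rule: finite_induct)
  case empty
  show ?case by (intro exI[of _ 1]) auto
next
  case (insert j I)
  obtain r where r: "r > 0" "\<forall>i\<in>I. P i r" using insert.IH insert.prems by blast
  obtain r' where r': "r' > 0" "P j r'" using insert.prems by blast
  have "P i (min r r')" if "i \<in> insert j I" for i
    using that r r' insert.prems(2)[of i r "min r r'"] insert.prems(2)[of i r' "min r r'"] by auto
  then show ?case using r r' by (intro exI[of _ "min r r'"]) auto
qed

text \<open>Greedy selection: keep one element, discard the at most \<open>n\<close> elements
  related to it, and continue with the rest. \<open>R\<close> need not be symmetric, so both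
  directions are counted.\<close>

lemma separated_subset:
  fixes n :: nat
  assumes "finite J" "\<And>s. s \<in> J \<Longrightarrow> card {t\<in>J. R s t \<or> R t s \<or> s = t} \<le> n"
  shows "\<exists>J'\<subseteq>J. card J \<le> n * card J' \<and> (\<forall>s\<in>J'. \<forall>t\<in>J'. s \<noteq> t \<longrightarrow> \<not> R s t)"
  using assms
proof (induction J rule: finite_psubset_induct)
  case (psubset J)
  show ?case
  proof (cases "J = {}")
    case False
    then obtain s where s: "s \<in> J" by blast
    define N where "N = {t\<in>J. R s t \<or> R t s \<or> s = t}"
    have N: "s \<in> N" "N \<subseteq> J" "card N \<le> n" using s psubset.prems by (auto simp: N_def)
    have "\<exists>J'\<subseteq>J - N. card (J - N) \<le> n * card J' \<and> (\<forall>s\<in>J'. \<forall>t\<in>J'. s \<noteq> t \<longrightarrow> \<not> R s t)"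
    proof (rule psubset.IH)
      show "J - N \<subset> J" using N by blast
      fix u assume u: "u \<in> J - N"
      have "card {t \<in> J - N. R u t \<or> R t u \<or> u = t} \<le> card {t \<in> J. R u t \<or> R t u \<or> u = t}"
        using psubset.hyps by (intro card_mono) auto
      then show "card {t \<in> J - N. R u t \<or> R t u \<or> u = t} \<le> n"
        using psubset.prems[of u] u by simp
    qed
    then obtain J' where J': "J' \<subseteq> J - N" "card (J - N) \<le> n * card J'"
      "\<forall>s\<in>J'. \<forall>t\<in>J'. s \<noteq> t \<longrightarrow> \<not> R s t" by blast
    have fin: "finite N" "finite J'"
      using N J' psubset.hyps by (auto intro: finite_subset)
    have "card J = card (J - N) + card N"
      using N fin psubset.hyps by (metis card_Diff_subset card_mono le_add_diff_inverse2)
    also have "\<dots> \<le> n * card (insert s J')"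
      using J' N fin by (subst card_insert_disjoint) auto
    finally have "card J \<le> n * card (insert s J')" .
    moreover have "\<forall>u\<in>insert s J'. \<forall>t\<in>insert s J'. u \<noteq> t \<longrightarrow> \<not> R u t"
      using J' by (auto simp: N_def)
    ultimately show ?thesis using J' s by (intro exI[of _ "insert s J'"]) auto
  qed auto
qed

section \<open>Group actions on a compact metric set\<close>

locale compact_action =
  fixes G :: "('g, 'm) monoid_scheme" (structure)
    and X :: "'x::metric_space set"
    and act :: "'g \<Rightarrow> 'x \<Rightarrow> 'x"
  assumes group: "group G"
    and compact: "compact X"
    and continuous: "continuous_action G X act"
begin

sublocale group G by (rule group)

sublocale group_action G X act
  using continuous by (simp add: continuous_action_def)

lemma act_closed [simp, intro]: "g \<in> carrier G \<Longrightarrow> x \<in> X \<Longrightarrow> act g x \<in> X"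
  by (rule element_image) auto

lemma act_mult: "g \<in> carrier G \<Longrightarrow> h \<in> carrier G \<Longrightarrow> x \<in> X \<Longrightarrow> act (g \<otimes> h) x = act g (act h x)"
  by (rule composition_rule)

lemma act_one [simp]: "x \<in> X \<Longrightarrow> act \<one> x = x"
  using id_eq_one by (metis restrict_apply')

lemma act_continuous: "g \<in> carrier G \<Longrightarrow> continuous_on X (act g)"
  using continuous by (auto simp: continuous_action_def homeomorphism_def)

lemma act_near:
  assumes "finite D" "D \<subseteq> carrier G" "x \<in> X" "\<theta> > 0"
  shows "\<exists>\<rho>>0. \<forall>g\<in>D. \<forall>p\<in>X. dist p x < \<rho> \<longrightarrow> dist (act g p) (act g x) \<le> \<theta>"
proof (rule uniform_radius)
  fix g assume "g \<in> D"
  then show "\<exists>\<rho>>0. \<forall>p\<in>X. dist p x < \<rho> \<longrightarrow> dist (act g p) (act g x) \<le> \<theta>"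
    using act_continuous[of g] assms unfolding continuous_on_iff
    by (meson less_imp_le subsetD)
qed (use assms in auto)

text \<open>Compactness bounds the distances, so the supremum is a genuine one;
  \<open>e \<ge> 0\<close> serves the empty \<open>K\<close>, where \<open>dist_on\<close> takes the
  default value 0.\<close>

lemma dist_on_le_iff:
  assumes "K \<subseteq> carrier G" "x \<in> X" "y \<in> X" "e \<ge> 0"
  shows "dist_on act K x y \<le> e \<longleftrightarrow> (\<forall>g\<in>K. dist (act g x) (act g y) \<le> e)"
proof (cases "K = {}")
  case False
  obtain b where b: "\<forall>u\<in>X. \<forall>v\<in>X. dist u v \<le> b"
    using compact_imp_bounded[OF compact] by (meson bounded_two_points)
  have "bdd_above ((\<lambda>g. dist (act g x) (act g y)) ` K)"
    using assms b by (intro bdd_aboveI2[of _ _ b]) auto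
  then show ?thesis using False by (simp add: dist_on_def cSUP_le_iff)
qed (use assms in \<open>simp add: dist_on_def\<close>)

section \<open>Uniform expansivity and pattern exchange\<close>

definition expansive_constant :: "real \<Rightarrow> bool" where
  "expansive_constant c \<longleftrightarrow>
     c > 0 \<and> (\<forall>x\<in>X. \<forall>y\<in>X. (\<forall>g\<in>carrier G. dist (act g x) (act g y) \<le> c) \<longrightarrow> x = y)"

text \<open>The form in which expansivity becomes quantitative: for a suitable finite
  \<open>K\<close>, a crude bound \<open>c\<close> on a window of times is turned into an
  arbitrarily fine one at its base time.\<close>

definition controls :: "'g set \<Rightarrow> real \<Rightarrow> real \<Rightarrow> bool" where
  "controls K c \<alpha> \<longleftrightarrow>
     (\<forall>x\<in>X. \<forall>y\<in>X. (\<forall>k\<in>K. dist (act k x) (act k y) \<le> c) \<longrightarrow> dist x y < \<alpha>)"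

text \<open>The exchange property of a memory set, with its suprema replaced by pointwise
  bounds.\<close>

definition exchangeable :: "real \<Rightarrow> real \<Rightarrow> 'g set \<Rightarrow> 'g set \<Rightarrow> bool" where
  "exchangeable \<epsilon> \<delta> A B \<longleftrightarrow>
     (\<forall>x\<in>X. \<forall>y\<in>X. (\<forall>g\<in>B - A. dist (act g x) (act g y) \<le> \<delta>) \<longrightarrow>
        (\<exists>z\<in>X. (\<forall>g\<in>B. dist (act g x) (act g z) \<le> \<epsilon>) \<and>
               (\<forall>g\<in>carrier G - A. dist (act g y) (act g z) \<le> \<epsilon>)))"

text \<open>Compactness: if every finite window failed, the closed sets \<open>Z g\<close> would
  have the finite intersection property. A common element would be a pair at distance at least
  \<open>\<alpha>\<close> that never separates beyond \<open>c\<close>, against expansivity.\<close>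

lemma expansive_uniform:
  assumes c: "expansive_constant c" and "\<alpha> > 0"
  obtains K where "finite K" "K \<subseteq> carrier G" "controls K c \<alpha>"
proof (rule ccontr)
  note obt = that
  assume contr: "\<not> thesis"
  define Z where "Z g = {z \<in> X \<times> X. \<alpha> \<le> dist (fst z) (snd z) \<and>
    dist (act g (fst z)) (act g (snd z)) \<le> c}" for g
  have closed: "closed (Z g)" if g: "g \<in> carrier G" for g
  proof -
    have XX: "closed (X \<times> X)" using compact by (simp add: closed_Times compact_imp_closed)
    have "continuous_on (X \<times> X) (\<lambda>z. act g (fst z))" "continuous_on (X \<times> X) (\<lambda>z. act g (snd z))"
      by (rule continuous_on_compose2[OF act_continuous[OF g]]; auto intro!: continuous_intros)+
    then have "closed {z \<in> X \<times> X. \<alpha> \<le> dist (fst z) (snd z)}"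
      "closed {z \<in> X \<times> X. dist (act g (fst z)) (act g (snd z)) \<le> c}"
      by (intro continuous_closed_preimage_constant continuous_on_closed_Collect_le XX
          continuous_intros; simp)+
    moreover have "Z g = {z \<in> X \<times> X. \<alpha> \<le> dist (fst z) (snd z)} \<inter>
        {z \<in> X \<times> X. dist (act g (fst z)) (act g (snd z)) \<le> c}"
      unfolding Z_def by auto
    ultimately show ?thesis by (simp add: closed_Int)
  qed
  have "(X \<times> X) \<inter> \<Inter>(Z ` carrier G) \<noteq> {}"
  proof (rule compact_imp_fip_image)
    show "compact (X \<times> X)" using compact by (simp add: compact_Times)
    fix K assume K: "finite K" "K \<subseteq> carrier G"
    show "X \<times> X \<inter> \<Inter> (Z ` K) \<noteq> {}"
    proof
      assume empty: "X \<times> X \<inter> \<Inter> (Z ` K) = {}"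
      show False
      proof (rule notE[OF contr], rule obt[OF K])
        have "dist x y < \<alpha>"
          if xy: "x \<in> X" "y \<in> X" "\<forall>k\<in>K. dist (act k x) (act k y) \<le> c" for x y
        proof -
          have "(x, y) \<notin> \<Inter> (Z ` K)" using xy empty by blast
          then show ?thesis using xy by (auto simp: Z_def)
        qed
        then show "controls K c \<alpha>" by (simp add: controls_def)
      qed
    qed
  qed (use closed in auto)
  then obtain x y where xy: "x \<in> X" "y \<in> X" "\<And>g. g \<in> carrier G \<Longrightarrow> (x, y) \<in> Z g" by blast
  then have "x = y" using c by (auto simp: Z_def expansive_constant_def)
  then show False using xy(3)[OF one_closed] \<open>\<alpha> > 0\<close> by (simp add: Z_def)
qed

text \<open>Closeness up to the fixed bound \<open>c\<close> improves itself: for \<open>g\<close>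
  outside the finite set \<open>K^-1 A\<close> the whole window \<open>K g\<close> avoids
  \<open>A\<close>, so \<open>controls\<close> makes the points \<open>\<epsilon>\<close>-close at
  \<open>g\<close>.\<close>

lemma asymptotic_if_close_cofinitely:
  assumes c: "expansive_constant c" and x: "x \<in> X" and y: "y \<in> X" and A: "finite A"
    and close: "\<And>g. g \<in> carrier G - A \<Longrightarrow> dist (act g x) (act g y) \<le> c"
  shows "(x, y) \<in> asymptotic_pairs G X act"
  unfolding asymptotic_pairs_def
proof (clarsimp simp: x y)
  fix \<epsilon> :: real assume "\<epsilon> > 0"
  then obtain K where K: "finite K" "K \<subseteq> carrier G" "controls K c \<epsilon>"
    using expansive_uniform[OF c] by blast
  define F where "F = (\<lambda>(k, a). inv k \<otimes> a) ` (K \<times> (A \<inter> carrier G))"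
  have "dist (act g x) (act g y) \<le> \<epsilon>" if g: "g \<in> carrier G - F" for g
  proof -
    have "dist (act g x) (act g y) < \<epsilon>"
    proof (rule K(3)[unfolded controls_def, rule_format])
      fix k assume k: "k \<in> K"
      have kc: "k \<in> carrier G" using k K by auto
      have "k \<otimes> g \<notin> A"
      proof
        assume "k \<otimes> g \<in> A"
        moreover have "g = inv k \<otimes> (k \<otimes> g)" using kc g by (simp add: inv_solve_left)
        ultimately have "g \<in> F" unfolding F_def using k kc g by force
        then show False using g by simp
      qed
      then show "dist (act k (act g x)) (act k (act g y)) \<le> c"
        using close[of "k \<otimes> g"] kc g x y by (simp add: act_mult)
    qed (use g x y in auto)
    then show ?thesis by simp
  qed
  moreover have "finite F" "F \<subseteq> carrier G" using K A by (auto simp: F_def)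
  ultimately show "\<exists>F\<subseteq>carrier G. finite F \<and>
      (\<forall>g\<in>carrier G - F. dist (act g x) (act g y) \<le> \<epsilon>)" by blast
qed

text \<open>The order of quantifiers matters later: \<open>\<delta>\<close> depends on
  \<open>\<epsilon>\<close> alone, so \<open>A\<close> may be chosen afterwards in terms of
  \<open>\<delta>\<close>.\<close>

lemma markov_exchange:
  assumes "topological_markov G X act" "\<epsilon> > 0"
  obtains \<delta> where "\<delta> > 0"
    "\<And>A. finite A \<Longrightarrow> A \<subseteq> carrier G \<Longrightarrow> \<exists>B. finite B \<and> A \<subseteq> B \<and> B \<subseteq> carrier G \<and> exchangeable \<epsilon> \<delta> A B"
proof -
  obtain \<delta> where \<delta>: "\<delta> > 0" "\<And>A. finite A \<and> A \<subseteq> carrier G \<Longrightarrow> \<exists>B. memory_set G X act \<epsilon> \<delta> A B"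
    using assms unfolding topological_markov_def by blast
  show ?thesis
  proof (rule that[OF \<delta>(1)])
    fix A assume A: "finite A" "A \<subseteq> carrier G"
    then obtain B where B: "memory_set G X act \<epsilon> \<delta> A B" using \<delta>(2) by blast
    have fin: "finite B" "A \<subseteq> B" and sub: "B - A \<subseteq> carrier G" "B \<subseteq> carrier G"
      using B by (auto simp: memory_set_def)
    have mem: "\<forall>x\<in>X. \<forall>y\<in>X. dist_on act (B - A) x y \<le> \<delta> \<longrightarrow>
        (\<exists>z\<in>X. dist_on act B x z \<le> \<epsilon> \<and> dist_on act (carrier G - A) y z \<le> \<epsilon>)"
      using B by (simp add: memory_set_def)
    note iff = dist_on_le_iff[OF sub(1)] dist_on_le_iff[OF sub(2)]
      dist_on_le_iff[of "carrier G - A", OF Diff_subset]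
    have "\<exists>z\<in>X. (\<forall>g\<in>B. dist (act g x) (act g z) \<le> \<epsilon>) \<and>
        (\<forall>g\<in>carrier G - A. dist (act g y) (act g z) \<le> \<epsilon>)"
      if "x \<in> X" "y \<in> X" "\<forall>g\<in>B - A. dist (act g x) (act g y) \<le> \<delta>" for x y
    proof -
      have "dist_on act (B - A) x y \<le> \<delta>" using that \<delta>(1) iff(1)[of x y \<delta>] by simp
      then obtain z where "z \<in> X" "dist_on act B x z \<le> \<epsilon>" "dist_on act (carrier G - A) y z \<le> \<epsilon>"
        using mem \<open>x \<in> X\<close> \<open>y \<in> X\<close> by blast
      then show ?thesis
        using iff(2)[of x z \<epsilon>] iff(3)[of y z \<epsilon>] that(1,2) assms(2) by (intro bexI[of _ z]) simp_all
    qed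
    then have "exchangeable \<epsilon> \<delta> A B" by (simp add: exchangeable_def)
    then show "\<exists>B. finite B \<and> A \<subseteq> B \<and> B \<subseteq> carrier G \<and> exchangeable \<epsilon> \<delta> A B"
      using fin sub(2) by blast
  qed
qed

lemma expansive_obtain_constant:
  assumes "expansive G X act"
  obtains c where "expansive_constant c"
proof -
  obtain c where "c > 0"
    "\<forall>x\<in>X. \<forall>y\<in>X. x \<noteq> y \<longrightarrow> (\<exists>g\<in>carrier G. dist (act g x) (act g y) > c)"
    using assms unfolding expansive_def by blast
  then have "expansive_constant c"
    unfolding expansive_constant_def not_le[symmetric] by blast
  then show ?thesis by (rule that)
qed

section \<open>Perturbation of asymptotic pairs and density of asymptotic tuples\<close>

lemma asymptotic_common_set:
  assumes "\<forall>y\<in>Y. (x, y) \<in> asymptotic_pairs G X act" "finite Y" "\<epsilon> > 0"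
  shows "\<exists>A. finite A \<and> A \<subseteq> carrier G \<and> \<one> \<in> A \<and>
    (\<forall>y\<in>Y. \<forall>g\<in>carrier G - A. dist (act g x) (act g y) \<le> \<epsilon>)"
proof -
  have "\<forall>y\<in>Y. \<exists>F\<subseteq>carrier G. finite F \<and> (\<forall>g\<in>carrier G - F. dist (act g x) (act g y) \<le> \<epsilon>)"
    using assms unfolding asymptotic_pairs_def by blast
  from bchoice[OF this] obtain F where F: "\<forall>y\<in>Y. F y \<subseteq> carrier G \<and> finite (F y) \<and>
      (\<forall>g\<in>carrier G - F y. dist (act g x) (act g y) \<le> \<epsilon>)" ..
  \<comment> \<open>The neutral element is added so that an estimate on the set includes one for the
    points themselves.\<close>
  let ?A = "insert \<one> (\<Union>y\<in>Y. F y)"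
  have "finite ?A" "?A \<subseteq> carrier G" "\<one> \<in> ?A"
    "\<forall>y\<in>Y. \<forall>g\<in>carrier G - ?A. dist (act g x) (act g y) \<le> \<epsilon>"
    using F assms(2) by auto
  then show ?thesis by blast
qed

text \<open>The finite piece of the orbit of \<open>u\<close> that differs noticeably from that of
  \<open>w\<close> is transplanted into the orbit of a nearby \<open>w'\<close>.\<close>

lemma asymptotic_exchange:
  assumes exp: "expansive G X act" and tmp: "topological_markov G X act"
    and asym: "(w, u) \<in> asymptotic_pairs G X act" and \<eta>: "\<eta> > 0"
  shows "\<exists>\<rho>>0. \<forall>w'\<in>X. dist w' w < \<rho> \<longrightarrow>
    (\<exists>v. (w', v) \<in> asymptotic_pairs G X act \<and> dist v u < \<eta>)"
proof -
  have wu: "w \<in> X" "u \<in> X" using asym by (auto simp: asymptotic_pairs_def)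
  obtain c where c: "expansive_constant c"
    using expansive_obtain_constant[OF exp] by blast
  then have "c > 0" by (simp add: expansive_constant_def)
  \<comment> \<open>At most \<open>c\<close>, so that \<open>v\<close> will be asymptotic to
    \<open>w'\<close>; below \<open>\<eta>\<close>, so that \<open>v\<close> will be near
    \<open>u\<close> at time \<open>\<one>\<close>, which lies in \<open>A\<close>.\<close>
  define \<epsilon> where "\<epsilon> = min c (\<eta> / 2)"
  have \<epsilon>: "\<epsilon> > 0" "\<epsilon> \<le> c" "\<epsilon> < \<eta>" using \<open>c > 0\<close> \<eta> by (auto simp: \<epsilon>_def)
  obtain \<delta> where \<delta>: "\<delta> > 0"
    "\<And>A. finite A \<Longrightarrow> A \<subseteq> carrier G \<Longrightarrow> \<exists>B. finite B \<and> A \<subseteq> B \<and> B \<subseteq> carrier G \<and>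
      exchangeable \<epsilon> \<delta> A B"
    using markov_exchange[OF tmp \<epsilon>(1)] by blast
  obtain A where A: "finite A" "A \<subseteq> carrier G" "\<one> \<in> A"
    "\<And>g. g \<in> carrier G - A \<Longrightarrow> dist (act g w) (act g u) \<le> \<delta> / 2"
    using asymptotic_common_set[of "{u}" w "\<delta> / 2"] asym half_gt_zero[OF \<delta>(1)] by blast
  obtain B where B: "finite B" "A \<subseteq> B" "B \<subseteq> carrier G" "exchangeable \<epsilon> \<delta> A B"
    using \<delta>(2)[OF A(1,2)] by blast
  obtain \<rho> where \<rho>: "\<rho> > 0"
    "\<And>p g. p \<in> X \<Longrightarrow> dist p w < \<rho> \<Longrightarrow> g \<in> B \<Longrightarrow> dist (act g p) (act g w) \<le> \<delta> / 2"
    using act_near[OF B(1,3) wu(1) half_gt_zero[OF \<delta>(1)]] by blast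
  have "\<exists>v. (w', v) \<in> asymptotic_pairs G X act \<and> dist v u < \<eta>"
    if w': "w' \<in> X" "dist w' w < \<rho>" for w'
  proof -
    \<comment> \<open>On \<open>B - A\<close> the point \<open>w'\<close> is near \<open>w\<close>
      by continuity, and \<open>w\<close> is near \<open>u\<close> because \<open>A\<close> holds
      all exceptional times. Hence some \<open>v\<close> copies \<open>u\<close> on \<open>B\<close>
      and \<open>w'\<close> off \<open>A\<close>.\<close>
    have "dist (act g u) (act g w') \<le> \<delta>" if "g \<in> B - A" for g
      using \<rho>(2)[OF w', of g] A(4)[of g] that B(3)
        dist_triangle[of "act g u" "act g w'" "act g w"] by (auto simp: dist_commute)
    then obtain v where v: "v \<in> X" "\<forall>g\<in>B. dist (act g u) (act g v) \<le> \<epsilon>"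
        "\<forall>g\<in>carrier G - A. dist (act g w') (act g v) \<le> \<epsilon>"
      using B(4) wu(2) w'(1) unfolding exchangeable_def by blast
    have "dist (act \<one> u) (act \<one> v) \<le> \<epsilon>" using v(2) A(3) B(2) by blast
    then have "dist v u < \<eta>" using \<epsilon> v(1) wu by (simp add: dist_commute)
    moreover have "(w', v) \<in> asymptotic_pairs G X act"
      by (rule asymptotic_if_close_cofinitely[OF c w'(1) v(1) A(1)]) (use v(3) \<epsilon>(2) in force)+
    ultimately show ?thesis by blast
  qed
  then show ?thesis using \<rho>(1) by blast
qed

text \<open>The common partner \<open>w\<close> changes at every step of the induction on the list,
  so only the distances to \<open>xs\<close> are recorded. Half of \<open>\<eta>\<close> goes to the
  induction hypothesis, half to moving the earlier entries to the new partner.\<close>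

lemma asymptotic_tuples_dense:
  assumes exp: "expansive G X act" and tmp: "topological_markov G X act"
    and dense: "top_of_set (X \<times> X) closure_of asymptotic_pairs G X act = X \<times> X"
    and "X \<noteq> {}" "set xs \<subseteq> X" "\<eta> > 0"
  shows "\<exists>w us. w \<in> X \<and> list_all2 (\<lambda>u x. (w, u) \<in> asymptotic_pairs G X act \<and> dist u x < \<eta>) us xs"
  using assms(5,6)
proof (induction xs arbitrary: \<eta>)
  case Nil
  obtain w where "w \<in> X" using \<open>X \<noteq> {}\<close> by blast
  moreover have "list_all2 (\<lambda>u x. (w, u) \<in> asymptotic_pairs G X act \<and> dist u x < \<eta>) [] []"
    by (rule list.rel_intros)
  ultimately show ?case by (intro exI conjI)
next
  case (Cons x xs)
  obtain w us where w: "w \<in> X"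
    and us: "list_all2 (\<lambda>u x. (w, u) \<in> asymptotic_pairs G X act \<and> dist u x < \<eta> / 2) us xs"
    using Cons.IH[OF subset_trans[OF set_subset_Cons Cons.prems(1)] half_gt_zero[OF Cons.prems(2)]]
    by (elim exE conjE) (rule that)
  have asym: "(w, u) \<in> asymptotic_pairs G X act" if "u \<in> set us" for u
    using us that unfolding list_all2_conv_all_nth in_set_conv_nth by auto
  \<comment> \<open>One radius for all earlier entries is fixed before density at
    \<open>(w, x)\<close> supplies the new partner \<open>w'\<close> and the new entry
    \<open>u'\<close>.\<close>
  have "\<exists>\<rho>>0. \<forall>u\<in>set us. \<forall>w'\<in>X. dist w' w < \<rho> \<longrightarrow>
      (\<exists>v. (w', v) \<in> asymptotic_pairs G X act \<and> dist v u < \<eta> / 2)"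
  proof (rule uniform_radius)
    fix u assume u: "u \<in> set us"
    show "\<exists>\<rho>>0. \<forall>w'\<in>X. dist w' w < \<rho> \<longrightarrow>
      (\<exists>v. (w', v) \<in> asymptotic_pairs G X act \<and> dist v u < \<eta> / 2)"
      by (rule asymptotic_exchange[OF exp tmp asym[OF u] half_gt_zero[OF Cons.prems(2)]])
  next
    fix u r r' assume "\<forall>w'\<in>X. dist w' w < r \<longrightarrow>
      (\<exists>v. (w', v) \<in> asymptotic_pairs G X act \<and> dist v u < \<eta> / 2)" "r' \<le> r"
    then show "\<forall>w'\<in>X. dist w' w < r' \<longrightarrow>
      (\<exists>v. (w', v) \<in> asymptotic_pairs G X act \<and> dist v u < \<eta> / 2)"
      by (simp add: less_le_trans)
  qed simp
  then obtain \<rho> where \<rho>: "\<rho> > 0" "\<And>u w'. u \<in> set us \<Longrightarrow> w' \<in> X \<Longrightarrow> dist w' w < \<rho> \<Longrightarrow>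
      \<exists>v. (w', v) \<in> asymptotic_pairs G X act \<and> dist v u < \<eta> / 2" by blast
  have "(w, x) \<in> top_of_set (X \<times> X) closure_of asymptotic_pairs G X act"
    using dense w Cons.prems by simp
  moreover have "openin (top_of_set (X \<times> X)) ((X \<times> X) \<inter> (ball w \<rho> \<times> ball x \<eta>))"
    by (intro openin_open_Int open_Times) auto
  moreover have "(w, x) \<in> (X \<times> X) \<inter> (ball w \<rho> \<times> ball x \<eta>)" using w \<rho> Cons.prems by auto
  ultimately have "\<exists>z. z \<in> asymptotic_pairs G X act \<and> z \<in> (X \<times> X) \<inter> (ball w \<rho> \<times> ball x \<eta>)"
    unfolding in_closure_of by (elim conjE allE impE) (assumption | rule conjI)+
  then obtain z where z: "z \<in> asymptotic_pairs G X act" "z \<in> (X \<times> X) \<inter> (ball w \<rho> \<times> ball x \<eta>)"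
    by (elim exE conjE) (rule that)
  obtain w' u' where "z = (w', u')" by (cases z)
  with z have u': "(w', u') \<in> asymptotic_pairs G X act" "w' \<in> X" "dist w' w < \<rho>" "dist u' x < \<eta>"
    by (simp_all add: dist_commute)
  have "\<forall>u\<in>set us. \<exists>v. (w', v) \<in> asymptotic_pairs G X act \<and> dist v u < \<eta> / 2"
    using \<rho>(2)[OF _ u'(2,3)] by simp
  from bchoice[OF this] obtain f
    where f: "\<forall>u\<in>set us. (w', f u) \<in> asymptotic_pairs G X act \<and> dist (f u) u < \<eta> / 2" ..
  have "dist (f u) x < \<eta>" if "u \<in> set us" "dist u x < \<eta> / 2" for u x
    using bspec[OF f that(1)] that(2) dist_triangle[of "f u" x u] by linarith
  then have "list_all2 (\<lambda>u x. (w', u) \<in> asymptotic_pairs G X act \<and> dist u x < \<eta>) (map f us) xs"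
    using us f by (simp add: list_all2_conv_all_nth)
  then have "list_all2 (\<lambda>u x. (w', u) \<in> asymptotic_pairs G X act \<and> dist u x < \<eta>)
      (u' # map f us) (x # xs)"
    using u' by (simp only: list_all2_Cons simp_thms)
  with u'(2) show ?case by (intro exI conjI)
qed

section \<open>Gluing along separated times and independence of asymptotic tuples\<close>

text \<open>
  The rough estimates \<open>R1\<close>, \<open>R2\<close>, \<open>R3\<close> in the induction step carry the additional error \<open>\<epsilon>\<close> of the
  exchange; since they stay below the expansivity constant, \<open>K\<close> improves them to \<open>\<alpha> / 2\<close>.
\<close>

lemma markov_gluing:
  assumes A: "A \<subseteq> carrier G" and D: "D \<subseteq> carrier G" and K: "K \<subseteq> carrier G"
    and AB: "A \<subseteq> B" and BD: "B \<subseteq> D"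
    and KA: "\<And>k a. k \<in> K \<Longrightarrow> a \<in> A \<Longrightarrow> k \<otimes> a \<in> D"
    and K'A: "\<And>k a. k \<in> K \<Longrightarrow> a \<in> A \<Longrightarrow> inv k \<otimes> a \<in> D"
    and KK'A: "\<And>k k' a. k \<in> K \<Longrightarrow> k' \<in> K \<Longrightarrow> a \<in> A \<Longrightarrow> k' \<otimes> (inv k \<otimes> a) \<in> D"
    and expK: "controls K c (\<alpha> / 2)" and mem: "exchangeable \<epsilon> \<delta> A B"
    and bounds: "\<alpha> > 0" "\<theta> \<le> \<alpha> / 2" "\<alpha> + \<theta> \<le> \<delta>" "0 \<le> \<theta>" "\<alpha> + \<epsilon> + \<theta> \<le> c"
    and S: "finite S" "S \<subseteq> carrier G"
    and sep: "\<And>s t a d. s \<in> S \<Longrightarrow> t \<in> S \<Longrightarrow> s \<noteq> t \<Longrightarrow> d \<in> D \<Longrightarrow> a \<in> A \<Longrightarrow> d \<otimes> s \<noteq> a \<otimes> t"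
    and p: "p \<in> X" and y: "\<And>s. s \<in> S \<Longrightarrow> y s \<in> X"
    and py: "\<And>s d. s \<in> S \<Longrightarrow> d \<in> D - A \<Longrightarrow> dist (act (d \<otimes> s) p) (act d (y s)) \<le> \<theta>"
  shows "\<exists>z\<in>X. (\<forall>s\<in>S. \<forall>a\<in>A. dist (act (a \<otimes> s) z) (act a (y s)) \<le> \<alpha>) \<and>
     (\<forall>g\<in>carrier G. (\<forall>s\<in>S. \<forall>a\<in>A. g \<noteq> a \<otimes> s) \<longrightarrow> dist (act g z) (act g p) \<le> \<alpha>)"
  using S sep y py
proof (induction S rule: finite_induct)
  case empty
  then show ?case using p bounds(1) by (intro bexI[of _ p]) auto
next
  case (insert t S)
  note sep = insert.prems(2) and y = insert.prems(3) and py = insert.prems(4)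
  have t: "t \<in> carrier G" and Sc: "\<And>s. s \<in> insert t S \<Longrightarrow> s \<in> carrier G"
    using insert.prems(1) by auto
  have "\<exists>z\<in>X. (\<forall>s\<in>S. \<forall>a\<in>A. dist (act (a \<otimes> s) z) (act a (y s)) \<le> \<alpha>) \<and>
     (\<forall>g\<in>carrier G. (\<forall>s\<in>S. \<forall>a\<in>A. g \<noteq> a \<otimes> s) \<longrightarrow> dist (act g z) (act g p) \<le> \<alpha>)"
  proof (rule insert.IH)
    show "S \<subseteq> carrier G" using insert.prems(1) by simp
  qed (use sep y py in auto)
  then obtain z where z: "z \<in> X"
    and za: "\<And>s a. s \<in> S \<Longrightarrow> a \<in> A \<Longrightarrow> dist (act (a \<otimes> s) z) (act a (y s)) \<le> \<alpha>"
    and zp: "\<And>g. g \<in> carrier G \<Longrightarrow> \<forall>s\<in>S. \<forall>a\<in>A. g \<noteq> a \<otimes> s \<Longrightarrow> dist (act g z) (act g p) \<le> \<alpha>"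
    by blast
  have yt: "y t \<in> X" and tz: "act t z \<in> X" using y t z by auto
  \<comment> \<open>By separation \<open>g \<otimes> t\<close> lies in no earlier zone
    \<open>A s\<close>, so \<open>z\<close> still follows \<open>p\<close> there, and
    \<open>p\<close> follows \<open>y t\<close>; the errors \<open>\<alpha> + \<theta>\<close> fit
    below \<open>\<delta>\<close>.\<close>
  have close: "dist (act g (y t)) (act g (act t z)) \<le> \<delta>" if g: "g \<in> B - A" for g
  proof -
    have gD: "g \<in> D" "g \<in> carrier G" using g BD D by auto
    have "\<forall>s\<in>S. \<forall>a\<in>A. g \<otimes> t \<noteq> a \<otimes> s"
      using sep[of t _ g] gD insert.hyps(2) by auto
    then have "dist (act (g \<otimes> t) z) (act (g \<otimes> t) p) \<le> \<alpha>" using zp gD t by auto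
    moreover have "dist (act (g \<otimes> t) p) (act g (y t)) \<le> \<theta>" using py[of t g] g gD by auto
    ultimately have "dist (act (g \<otimes> t) z) (act g (y t)) \<le> \<delta>"
      using bounds dist_triangle[of "act (g \<otimes> t) z" "act g (y t)" "act (g \<otimes> t) p"] by linarith
    then show ?thesis using gD t z by (simp add: act_mult dist_commute)
  qed
  obtain v where v: "v \<in> X" "\<And>g. g \<in> B \<Longrightarrow> dist (act g (y t)) (act g v) \<le> \<epsilon>"
      "\<And>g. g \<in> carrier G - A \<Longrightarrow> dist (act g (act t z)) (act g v) \<le> \<epsilon>"
    using mem[unfolded exchangeable_def, rule_format, OF yt tz close] by blast
  \<comment> \<open>The exchange was made for the translate \<open>act t z\<close>; this moves its
    result back, so that \<open>z\<close> and \<open>z'\<close> differ noticeably only on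
    \<open>A t\<close>.\<close>
  define z' where "z' = act (inv t) v"
  have z': "z' \<in> X" "act t z' = v"
    using v(1) t act_mult[of t "inv t" v] by (auto simp: z'_def)
  have zz': "dist (act g z) (act g z') \<le> \<epsilon>"
    if g: "g \<in> carrier G" "\<forall>a\<in>A. g \<noteq> a \<otimes> t" for g
  proof -
    have eq: "g = (g \<otimes> inv t) \<otimes> t" using g t by (simp add: m_assoc)
    then have "g \<otimes> inv t \<notin> A" using g(2) by auto
    then have "dist (act (g \<otimes> inv t) (act t z)) (act (g \<otimes> inv t) (act t z')) \<le> \<epsilon>"
      using v(3)[of "g \<otimes> inv t"] g t z' by simp
    then show ?thesis
      using act_mult[of "g \<otimes> inv t" t z] act_mult[of "g \<otimes> inv t" t z'] g t z z' eq by simp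
  qed
  \<comment> \<open>At the new visit the error is that of the exchange alone; at an earlier one,
    separation keeps \<open>a \<otimes> s\<close> out of \<open>A t\<close>, so the exchange only
    adds \<open>\<epsilon>\<close>.\<close>
  have R1: "dist (act (a \<otimes> s) z') (act a (y s)) \<le> \<alpha> + \<epsilon>" if s: "s \<in> insert t S" and a: "a \<in> A" for s a
  proof (cases "s = t")
    case True
    have "dist (act a v) (act a (y t)) \<le> \<epsilon>" using v(2)[of a] a AB by (auto simp: dist_commute)
    then show ?thesis using True z' t a A bounds(1) act_mult[of a t z'] by force
  next
    case False
    then have sS: "s \<in> S" using s by simp
    have aD: "a \<in> D" using a AB BD by blast
    have "\<forall>a'\<in>A. a \<otimes> s \<noteq> a' \<otimes> t" using sep[of s t a] s False aD by auto
    then have "dist (act (a \<otimes> s) z) (act (a \<otimes> s) z') \<le> \<epsilon>" using zz'[of "a \<otimes> s"] a A Sc[OF s] by auto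
    then show ?thesis
      using za[OF sS a] dist_triangle3[of "act (a \<otimes> s) z'" "act a (y s)" "act (a \<otimes> s) z"] by linarith
  qed
  have R2: "dist (act g z') (act g p) \<le> \<alpha> + \<epsilon>"
    if g: "g \<in> carrier G" "\<forall>s\<in>insert t S. \<forall>a\<in>A. g \<noteq> a \<otimes> s" for g
    using zz'[of g] zp[of g] g dist_triangle3[of "act g z'" "act g p" "act g z"] by force
  \<comment> \<open>For a single visit this is cancellation, for two different visits it is
    separation.\<close>
  have off: "d \<otimes> s \<noteq> a \<otimes> s'" if "s \<in> insert t S" "s' \<in> insert t S" "d \<in> D - A" "a \<in> A" for s s' d a
  proof (cases "s = s'")
    case True
    have "d \<in> carrier G" "a \<in> carrier G" "d \<noteq> a" using that D A by auto
    then show ?thesis using True Sc[OF that(1)] by simp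
  next
    case False
    then show ?thesis using sep[of s s' d a] that by auto
  qed
  \<comment> \<open>The pattern \<open>y s\<close> is followed on the larger zone
    \<open>D s\<close>: outside \<open>A\<close> the point \<open>z'\<close> follows
    \<open>p\<close>, which follows \<open>y s\<close> there.\<close>
  have R3: "dist (act (d \<otimes> s) z') (act d (y s)) \<le> \<alpha> + \<epsilon> + \<theta>" if s: "s \<in> insert t S" and d: "d \<in> D" for s d
  proof (cases "d \<in> A")
    case True
    then show ?thesis using R1[OF s True] bounds by linarith
  next
    case False
    have "dist (act (d \<otimes> s) z') (act (d \<otimes> s) p) \<le> \<alpha> + \<epsilon>"
      using R2[of "d \<otimes> s"] off[OF s] d D False Sc[OF s] by auto
    then show ?thesis using py[OF s, of d] d False
        dist_triangle[of "act (d \<otimes> s) z'" "act d (y s)" "act (d \<otimes> s) p"] by force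
  qed
  \<comment> \<open>If the window \<open>K g\<close> lies in \<open>D\<close>, then
    \<open>R3\<close> bounds all its errors by \<open>c\<close>, which is what
    \<open>controls\<close> improves.\<close>
  have I1: "dist (act (g \<otimes> s) z') (act g (y s)) < \<alpha> / 2"
    if s: "s \<in> insert t S" and g: "g \<in> carrier G" "\<And>k. k \<in> K \<Longrightarrow> k \<otimes> g \<in> D" for s g
  proof (rule expK[unfolded controls_def, rule_format])
    fix k assume k: "k \<in> K"
      have kc: "k \<in> carrier G" using k K by auto
      have "dist (act (k \<otimes> g \<otimes> s) z') (act (k \<otimes> g) (y s)) \<le> c"
        using R3[OF s g(2)[OF k]] bounds by linarith
      then show "dist (act k (act (g \<otimes> s) z')) (act k (act g (y s))) \<le> c"
        using kc g Sc[OF s] z' y[OF s] by (simp add: act_mult m_assoc)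
  qed (use s g Sc z' y in auto)
  have "dist (act (a \<otimes> s) z') (act a (y s)) \<le> \<alpha>" if s: "s \<in> insert t S" and a: "a \<in> A" for s a
    using I1[OF s, of a] KA a A bounds(1) by force
  moreover have "dist (act g z') (act g p) \<le> \<alpha>"
    if g: "g \<in> carrier G" and ng: "\<forall>s\<in>insert t S. \<forall>a\<in>A. g \<noteq> a \<otimes> s" for g
  \<comment> \<open>If the window \<open>K g\<close> misses every zone \<open>A s\<close>,
    comparison with \<open>p\<close> is direct. Otherwise \<open>g = h \<otimes> s\<close> with
    \<open>h\<close> in \<open>K^-1 A\<close> but not in \<open>A\<close>; then \<open>z'\<close>
    and \<open>p\<close> are both compared with \<open>y s\<close>, each within
    \<open>\<alpha> / 2\<close>. Here \<open>KK'A\<close> puts the window of \<open>h\<close> into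
    \<open>D\<close>.\<close>
  proof (cases "\<forall>k\<in>K. \<forall>s\<in>insert t S. \<forall>a\<in>A. k \<otimes> g \<noteq> a \<otimes> s")
    case True
    have "dist (act g z') (act g p) < \<alpha> / 2"
    proof (rule expK[unfolded controls_def, rule_format])
      fix k assume k: "k \<in> K"
        have kc: "k \<in> carrier G" using k K by auto
        have "dist (act (k \<otimes> g) z') (act (k \<otimes> g) p) \<le> \<alpha> + \<epsilon>"
          using R2[of "k \<otimes> g"] kc g True k by blast
        then show "dist (act k (act g z')) (act k (act g p)) \<le> c"
          using kc g z' p bounds by (simp add: act_mult)
    qed (use g z' p in auto)
    then show ?thesis using bounds(1) by linarith
  next
    case False
    then obtain k s a where k: "k \<in> K" and s: "s \<in> insert t S" and a: "a \<in> A"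
      and eq: "k \<otimes> g = a \<otimes> s" by blast
    have kc: "k \<in> carrier G" "a \<in> carrier G" "s \<in> carrier G" using k a K A Sc[OF s] by auto
    define h where "h = inv k \<otimes> a"
    have h: "h \<in> carrier G" "h \<in> D" using kc K'A k a by (auto simp: h_def)
    have gh: "g = h \<otimes> s"
      using eq kc g unfolding h_def by (metis inv_closed inv_solve_left m_assoc m_closed)
    have "h \<notin> A" using ng gh s by blast
    have "dist (act g z') (act h (y s)) < \<alpha> / 2"
      unfolding gh by (rule I1[OF s h(1)]) (use KK'A k a in \<open>auto simp: h_def\<close>)
    moreover have "dist (act g p) (act h (y s)) \<le> \<theta>"
      unfolding gh using py[OF s, of h] h \<open>h \<notin> A\<close> by auto
    ultimately show ?thesis
      using dist_triangle2[of "act g z'" "act g p" "act h (y s)"] bounds by linarith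
  qed
  ultimately show ?case using z' by blast
qed

text \<open>Times \<open>s\<close> and \<open>t\<close> can conflict only if \<open>t\<close> lies
  in \<open>M s\<close> for a fixed finite set \<open>M\<close>. So the loss factor does not depend
  on \<open>J\<close>, and positive density survives.\<close>

lemma thinning:
  assumes "finite A" "A \<subseteq> carrier G" "finite D" "D \<subseteq> carrier G"
  obtains n :: nat where "n > 0"
    "\<And>J. finite J \<Longrightarrow> J \<subseteq> carrier G \<Longrightarrow> \<exists>J'\<subseteq>J. card J \<le> n * card J' \<and>
       (\<forall>s\<in>J'. \<forall>t\<in>J'. s \<noteq> t \<longrightarrow> (\<forall>d\<in>D. \<forall>a\<in>A. d \<otimes> s \<noteq> a \<otimes> t))"
proof -
  define M where "M = insert \<one> ((\<lambda>(a, d). inv a \<otimes> d) ` (A \<times> D) \<union> (\<lambda>(a, d). inv d \<otimes> a) ` (A \<times> D))"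
  have M: "finite M" using assms by (simp add: M_def)
  define R where "R s t \<longleftrightarrow> (\<exists>d\<in>D. \<exists>a\<in>A. d \<otimes> s = a \<otimes> t)" for s t
  have solve: "t \<in> (\<lambda>m. m \<otimes> s) ` M"
    if st: "s \<in> carrier G" "t \<in> carrier G" "R s t \<or> R t s \<or> s = t" for s t
  proof -
    consider d a where "d \<in> D" "a \<in> A" "d \<otimes> s = a \<otimes> t" | d a where "d \<in> D" "a \<in> A" "d \<otimes> t = a \<otimes> s"
      | "s = t"
      using st(3) unfolding R_def by blast
    then show ?thesis
    proof cases
      case 1
      have "d \<in> carrier G" "a \<in> carrier G" using 1 assms by auto
      then have "t = (inv a \<otimes> d) \<otimes> s"
        using 1 st by (simp add: m_assoc inv_solve_left)
      moreover have "inv a \<otimes> d \<in> M" using 1 by (force simp: M_def)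
      ultimately show ?thesis by blast
    next
      case 2
      have "d \<in> carrier G" "a \<in> carrier G" using 2 assms by auto
      then have "t = (inv d \<otimes> a) \<otimes> s"
        using 2 st by (simp add: m_assoc inv_solve_left)
      moreover have "inv d \<otimes> a \<in> M" using 2 by (force simp: M_def)
      ultimately show ?thesis by blast
    next
      case 3
      then show ?thesis using st by (force simp: M_def)
    qed
  qed
  show ?thesis
  proof (rule that[of "card M"])
    show "card M > 0" using M by (auto simp: card_gt_0_iff M_def)
    fix J assume J: "finite J" "J \<subseteq> carrier G"
    have "\<exists>J'\<subseteq>J. card J \<le> card M * card J' \<and> (\<forall>s\<in>J'. \<forall>t\<in>J'. s \<noteq> t \<longrightarrow> \<not> R s t)"
    proof (rule separated_subset[OF J(1)])
      fix s assume s: "s \<in> J"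
      have "card {t \<in> J. R s t \<or> R t s \<or> s = t} \<le> card ((\<lambda>m. m \<otimes> s) ` M)"
        using solve s J M by (intro card_mono) auto
      also have "\<dots> \<le> card M" using M by (rule card_image_le)
      finally show "card {t \<in> J. R s t \<or> R t s \<or> s = t} \<le> card M" .
    qed
    then show "\<exists>J'\<subseteq>J. card J \<le> card M * card J' \<and>
       (\<forall>s\<in>J'. \<forall>t\<in>J'. s \<noteq> t \<longrightarrow> (\<forall>d\<in>D. \<forall>a\<in>A. d \<otimes> s \<noteq> a \<otimes> t))"
      by (simp add: R_def)
  qed
qed

text \<open>The choices run \<open>c\<close>, \<open>\<epsilon>\<close>, \<open>\<delta>\<close>,
  \<open>\<alpha>\<close>, \<open>\<theta>\<close>, then \<open>K\<close>, \<open>A\<close>,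
  \<open>B\<close>, \<open>D\<close>, \<open>\<rho>\<close>; this is not circular because
  \<open>\<delta>\<close> is fixed before \<open>A\<close>. A visit to the ball \<open>W\<close>
  around \<open>x\<close> shadows the orbit of \<open>x\<close> on all of \<open>D\<close>.\<close>

lemma IE_if_asymptotic:
  assumes exp: "expansive G X act" and tmp: "topological_markov G X act"
    and x: "[x] \<in> IE G X act 1"
    and asym: "\<And>y. y \<in> set ys \<Longrightarrow> (x, y) \<in> asymptotic_pairs G X act"
  shows "ys \<in> IE G X act (length ys)"
  unfolding IE_def
proof (safe)
  have xX: "x \<in> X" using x by (simp add: IE_def power_space_def)
  have yX: "y \<in> X" if "y \<in> set ys" for y using asym[OF that] by (simp add: asymptotic_pairs_def)
  then show "ys \<in> power_space X (length ys)" by (auto simp: power_space_def)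
  fix Us :: "'x set list"
  assume len: "length Us = length ys"
    and Us: "\<forall>i<length ys. Us ! i \<subseteq> X \<and> ys ! i \<in> top_of_set X interior_of (Us ! i)"
  have "\<exists>r>0. \<forall>i\<in>{..<length ys}. X \<inter> cball (ys ! i) r \<subseteq> Us ! i"
  proof (rule uniform_radius)
    fix i assume i: "i \<in> {..<length ys}"
    then obtain T where T: "openin (top_of_set X) T" "ys ! i \<in> T" "T \<subseteq> Us ! i"
      using Us unfolding interior_of_def by blast
    then obtain O' where O': "open O'" "T = X \<inter> O'" by (auto simp: openin_open)
    then obtain r where "r > 0" "cball (ys ! i) r \<subseteq> O'"
      using T(2) by (meson IntD2 open_contains_cball)
    then show "\<exists>r>0. X \<inter> cball (ys ! i) r \<subseteq> Us ! i" using O' T by blast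
  qed auto
  then obtain r where r: "r > 0" "\<And>i. i < length ys \<Longrightarrow> X \<inter> cball (ys ! i) r \<subseteq> Us ! i" by blast
  obtain c where c: "expansive_constant c"
    using expansive_obtain_constant[OF exp] by blast
  then have "c > 0" by (simp add: expansive_constant_def)
  \<comment> \<open>With \<open>\<alpha> \<le> c / 4\<close> and
    \<open>\<theta> = \<alpha> / 2\<close>, the total error
    \<open>\<alpha> + \<epsilon> + \<theta>\<close> is at most \<open>5 c / 8\<close>.\<close>
  define \<epsilon> where "\<epsilon> = c / 4"
  have \<epsilon>: "\<epsilon> > 0" using \<open>c > 0\<close> by (simp add: \<epsilon>_def)
  obtain \<delta> where \<delta>: "\<delta> > 0"
    "\<And>A. finite A \<Longrightarrow> A \<subseteq> carrier G \<Longrightarrow> \<exists>B. finite B \<and> A \<subseteq> B \<and> B \<subseteq> carrier G \<and>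
      exchangeable \<epsilon> \<delta> A B"
    using markov_exchange[OF tmp \<epsilon>] by blast
  \<comment> \<open>The bound \<open>r\<close> makes the glued point enter the sets of
    \<open>Us\<close>; \<open>\<delta> / 2\<close> leaves room for
    \<open>\<alpha> + \<theta> \<le> \<delta>\<close>.\<close>
  define \<alpha> where "\<alpha> = min r (min (c / 4) (\<delta> / 2))"
  define \<theta> where "\<theta> = \<alpha> / 2"
  have "\<alpha> > 0" "\<alpha> \<le> r" "\<alpha> \<le> c / 4" "\<alpha> \<le> \<delta> / 2" using r \<open>c > 0\<close> \<delta> by (auto simp: \<alpha>_def)
  then have bounds: "\<alpha> > 0" "\<theta> \<le> \<alpha> / 2" "\<alpha> + \<theta> \<le> \<delta>" "0 \<le> \<theta>" "\<alpha> + \<epsilon> + \<theta> \<le> c" and "\<theta> > 0" "\<alpha> \<le> r"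
    using \<open>c > 0\<close> by (auto simp: \<theta>_def \<epsilon>_def)
  obtain K where K: "finite K" "K \<subseteq> carrier G" "controls K c (\<alpha> / 2)"
    using expansive_uniform[OF c half_gt_zero[OF bounds(1)]] by blast
  obtain A where A: "finite A" "A \<subseteq> carrier G" "\<one> \<in> A"
    "\<And>y g. y \<in> set ys \<Longrightarrow> g \<in> carrier G - A \<Longrightarrow> dist (act g x) (act g y) \<le> \<theta> / 2"
    using asymptotic_common_set[OF _ finite_set half_gt_zero[OF \<open>\<theta> > 0\<close>], of ys x] asym by blast
  obtain B where B: "finite B" "A \<subseteq> B" "B \<subseteq> carrier G" "exchangeable \<epsilon> \<delta> A B"
    using \<delta>(2)[OF A(1,2)] by blast
  \<comment> \<open>The memory set together with the translates of \<open>A\<close> by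
    \<open>K\<close>, \<open>K^-1\<close> and \<open>K K^-1\<close> that the gluing asks
    for.\<close>
  define D where "D = B \<union> (\<lambda>(k, a). k \<otimes> a) ` (K \<times> A) \<union> (\<lambda>(k, a). inv k \<otimes> a) ` (K \<times> A)
    \<union> (\<lambda>(k', k, a). k' \<otimes> (inv k \<otimes> a)) ` (K \<times> K \<times> A)"
  have D: "finite D" "D \<subseteq> carrier G" "B \<subseteq> D"
    "\<And>k a. k \<in> K \<Longrightarrow> a \<in> A \<Longrightarrow> k \<otimes> a \<in> D"
    "\<And>k a. k \<in> K \<Longrightarrow> a \<in> A \<Longrightarrow> inv k \<otimes> a \<in> D"
    "\<And>k k' a. k \<in> K \<Longrightarrow> k' \<in> K \<Longrightarrow> a \<in> A \<Longrightarrow> k' \<otimes> (inv k \<otimes> a) \<in> D"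
  proof -
    show "finite D" "B \<subseteq> D" using A B K by (auto simp: D_def)
    show "D \<subseteq> carrier G" using A B K by (auto simp: D_def subset_iff)
    show "k \<otimes> a \<in> D" "inv k \<otimes> a \<in> D" if "k \<in> K" "a \<in> A" for k a
      using that by (force simp: D_def)+
    show "k' \<otimes> (inv k \<otimes> a) \<in> D" if "k \<in> K" "k' \<in> K" "a \<in> A" for k k' a
      using that unfolding D_def by (intro UnI2 image_eqI[of _ _ "(k', k, a)"]) auto
  qed
  obtain \<rho> where \<rho>: "\<rho> > 0"
    "\<And>p g. p \<in> X \<Longrightarrow> dist p x < \<rho> \<Longrightarrow> g \<in> D \<Longrightarrow> dist (act g p) (act g x) \<le> \<theta> / 2"
    using act_near[OF D(1,2) xX half_gt_zero[OF \<open>\<theta> > 0\<close>]] by blast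
  define W where "W = X \<inter> ball x \<rho>"
  have W: "openin (top_of_set X) W" "x \<in> W" "W \<subseteq> X"
    using xX \<rho> by (auto simp: W_def intro: openin_open_Int)
  define q where "q = independence_density G X act [W]"
  have "x \<in> top_of_set X interior_of W" using W by (simp add: interior_of_openin)
  then have "q > 0"
    using x W unfolding IE_def q_def by (auto dest!: spec[of _ "[W]"])
  have ne: "carrier G \<noteq> {}" by auto
  have q: "density_bound G X act [W] q"
    unfolding q_def by (rule independence_density_greatest(1)[OF ne])
  obtain n where n: "n > 0"
    "\<And>J. finite J \<Longrightarrow> J \<subseteq> carrier G \<Longrightarrow> \<exists>J'\<subseteq>J. card J \<le> n * card J' \<and>
       (\<forall>s\<in>J'. \<forall>t\<in>J'. s \<noteq> t \<longrightarrow> (\<forall>d\<in>D. \<forall>a\<in>A. d \<otimes> s \<noteq> a \<otimes> t))"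
    using thinning[OF A(1,2) D(1,2)] by blast
  have indep: "(\<Inter>s\<in>I. preimg X act s (Us ! \<phi> s)) \<noteq> {}"
    if I: "I \<noteq> {}" "finite I" "I \<subseteq> carrier G" and \<phi>: "\<phi> \<in> I \<rightarrow> {..<length Us}"
      and ind: "(\<Inter>s\<in>I. preimg X act s W) \<noteq> {}"
      and sep: "\<forall>s\<in>I. \<forall>t\<in>I. s \<noteq> t \<longrightarrow> (\<forall>d\<in>D. \<forall>a\<in>A. d \<otimes> s \<noteq> a \<otimes> t)" for I \<phi>
  proof -
    define y where "y s = ys ! \<phi> s" for s
    have \<phi>l: "\<phi> s < length ys" if "s \<in> I" for s using \<phi> that len by auto
    have yset: "y s \<in> set ys" if "s \<in> I" for s using \<phi>l[OF that] by (simp add: y_def)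
    obtain p where p: "\<And>s. s \<in> I \<Longrightarrow> p \<in> X \<and> act s p \<in> W" using ind by (auto simp: preimg_def)
    have pX: "p \<in> X" using p I by blast
    \<comment> \<open>Half of \<open>\<theta>\<close> pays for passing from \<open>p\<close> to
      \<open>x\<close> during a visit, half for passing from \<open>x\<close> to \<open>y s\<close>
      off \<open>A\<close>.\<close>
    have py: "dist (act (d \<otimes> s) p) (act d (y s)) \<le> \<theta>" if s: "s \<in> I" and d: "d \<in> D - A" for s d
    proof -
      have dc: "d \<in> carrier G - A" "s \<in> carrier G" using d D s I by auto
      have "dist (act d (act s p)) (act d x) \<le> \<theta> / 2"
        using \<rho>(2)[of "act s p" d] p[OF s] d by (auto simp: W_def dist_commute)
      moreover have "dist (act d x) (act d (y s)) \<le> \<theta> / 2" using A(4)[OF yset[OF s]] dc by auto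
      ultimately show ?thesis
        using dist_triangle[of "act d (act s p)" "act d (y s)" "act d x"] dc pX
        by (simp add: act_mult)
    qed
    have "\<exists>z\<in>X. (\<forall>s\<in>I. \<forall>a\<in>A. dist (act (a \<otimes> s) z) (act a (y s)) \<le> \<alpha>) \<and>
     (\<forall>g\<in>carrier G. (\<forall>s\<in>I. \<forall>a\<in>A. g \<noteq> a \<otimes> s) \<longrightarrow> dist (act g z) (act g p) \<le> \<alpha>)"
    proof (rule markov_gluing[OF A(2) D(2) K(2) B(2) D(3-6) K(3) B(4) bounds I(2,3) _ pX _ py])
      show "d \<otimes> s \<noteq> a \<otimes> t" if "s \<in> I" "t \<in> I" "s \<noteq> t" "d \<in> D" "a \<in> A" for s t a d
        using sep that by simp
      show "y s \<in> X" if "s \<in> I" for s using yX yset[OF that] by simp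
    qed
    then obtain z where z: "z \<in> X" "\<forall>s\<in>I. \<forall>a\<in>A. dist (act (a \<otimes> s) z) (act a (y s)) \<le> \<alpha>"
      by (elim bexE conjE) (rule that)
    have "act s z \<in> Us ! \<phi> s" if s: "s \<in> I" for s
    proof -
      have sc: "s \<in> carrier G" using s I by auto
      \<comment> \<open>The estimate on \<open>A\<close> is read off at the neutral element.\<close>
      have "dist (act s z) (y s) \<le> r"
        using bspec[OF bspec[OF z(2) s] A(3)] sc yX[OF yset[OF s]] \<open>\<alpha> \<le> r\<close> by simp
      then have "act s z \<in> X \<inter> cball (ys ! \<phi> s) r" using sc z(1) by (simp add: y_def dist_commute)
      then show ?thesis using r(2)[OF \<phi>l[OF s]] by blast
    qed
    then have "z \<in> (\<Inter>s\<in>I. preimg X act s (Us ! \<phi> s))" using z(1) by (simp add: preimg_def)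
    then show ?thesis by blast
  qed
  \<comment> \<open>Visits to \<open>W\<close> have density \<open>q\<close>, and thinning divides
    it by at most \<open>n\<close>.\<close>
  have "density_bound G X act Us (q / real n)"
    unfolding density_bound_def
  proof (intro conjI allI impI)
    show "0 \<le> q / real n" using \<open>q > 0\<close> by simp
    fix F assume F: "finite F \<and> F \<subseteq> carrier G"
    then obtain J where J: "J \<subseteq> F" "real (card J) \<ge> q * real (card F)" "independence_set G X act [W] J"
      using q unfolding density_bound_def by blast
    have Jf: "finite J" "J \<subseteq> carrier G" using J F by (auto intro: finite_subset)
    obtain J' where J': "J' \<subseteq> J" "card J \<le> n * card J'"
      "\<forall>s\<in>J'. \<forall>t\<in>J'. s \<noteq> t \<longrightarrow> (\<forall>d\<in>D. \<forall>a\<in>A. d \<otimes> s \<noteq> a \<otimes> t)" using n(2)[OF Jf] by blast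
    have "independence_set G X act Us J'"
      unfolding independence_set_def
    proof (intro conjI allI impI)
      show "J' \<subseteq> carrier G" using J' Jf by blast
      fix I \<phi> assume I: "I \<noteq> {} \<and> finite I \<and> I \<subseteq> J' \<and> \<phi> \<in> I \<rightarrow> {..<length Us}"
      \<comment> \<open>For the one-term tuple \<open>[W]\<close> the constant \<open>0\<close> is
        the only pattern on \<open>I\<close>.\<close>
      then have "I \<noteq> {} \<and> finite I \<and> I \<subseteq> J \<and> (\<lambda>_. 0) \<in> I \<rightarrow> {..<length [W]}" using J' by auto
      with J(3) have "(\<Inter>s\<in>I. preimg X act s ([W] ! 0)) \<noteq> {}"
        unfolding independence_set_def by (elim conjE allE[of _ I] allE[of _ "\<lambda>_. 0"]) simp
      then have W: "(\<Inter>s\<in>I. preimg X act s W) \<noteq> {}" by simp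
      have "I \<subseteq> carrier G" using I J'(1) Jf(2) by (meson subset_trans)
      moreover have "\<forall>s\<in>I. \<forall>t\<in>I. s \<noteq> t \<longrightarrow> (\<forall>d\<in>D. \<forall>a\<in>A. d \<otimes> s \<noteq> a \<otimes> t)"
        using I J'(3) by (meson subsetD)
      ultimately show "(\<Inter>s\<in>I. preimg X act s (Us ! \<phi> s)) \<noteq> {}"
        using I W by (intro indep) simp_all
    qed
    moreover have "q / real n * real (card F) \<le> real (card J')"
    proof -
      have "real (card J) \<le> real n * real (card J')" using J'(2) by (metis of_nat_le_iff of_nat_mult)
      then show ?thesis using J(2) n(1) by (simp add: field_simps)
    qed
    moreover have "J' \<subseteq> F" using J'(1) J(1) by (rule subset_trans)
    ultimately show "\<exists>J\<subseteq>F. q / real n * real (card F) \<le> real (card J) \<and> independence_set G X act Us J"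
      by (intro exI[of _ J'] conjI)
  qed
  then have "q / real n \<le> independence_density G X act Us"
    by (rule independence_density_greatest(2)[OF ne])
  moreover have "q / real n > 0" using \<open>q > 0\<close> n by simp
  ultimately show "independence_density G X act Us > 0" by linarith
qed

section \<open>From independence to entropy and naive UPE\<close>

text \<open>
  The points \<open>p \<phi>\<close> realising all patterns \<open>\<phi>\<close> on an independence set lie in different members of
  the joined cover, since at each time exactly one of the two sets of the cover is available.
\<close>

lemma min_subcover_ge_independence:
  assumes "C0 \<inter> C1 = {}"
    and J: "J \<noteq> {}" "J \<subseteq> F" "finite F" "F \<subseteq> carrier G" "independence_set G X act [C0, C1] J"
  shows "2 ^ card J \<le> min_subcover X (cover_join X act {X - C0, X - C1} F)"
proof -
  define \<U> where "\<U> = {X - C0, X - C1}"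
  let ?P = "\<lambda>n. \<exists>\<V>\<subseteq>cover_join X act \<U> F. finite \<V> \<and> \<Union>\<V> = X \<and> card \<V> = n"
  have Jf: "finite J" using J finite_subset by blast
  have F: "F \<noteq> {}" using J by blast
  have "\<Union>(cover_join X act \<U> F) = X"
  proof (intro subset_antisym subsetI)
    fix x assume "x \<in> \<Union>(cover_join X act \<U> F)"
    then show "x \<in> X" using F by (auto simp: cover_join_def preimg_def)
  next
    fix x assume x: "x \<in> X"
    \<comment> \<open>Disjointness guarantees that at each time some set of the cover contains the
      orbit point.\<close>
    define c where "c g = (if act g x \<in> C0 then X - C1 else X - C0)" for g
    have "x \<in> (\<Inter>g\<in>F. preimg X act g (c g))"
      using x J assms(1) by (auto simp: preimg_def c_def)
    moreover have "c \<in> F \<rightarrow> \<U>" by (auto simp: c_def \<U>_def)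
    ultimately show "x \<in> \<Union>(cover_join X act \<U> F)" unfolding cover_join_def by blast
  qed
  moreover have "finite (cover_join X act \<U> F)"
  proof -
    have "cover_join X act \<U> F \<subseteq> (\<lambda>c. \<Inter>g\<in>F. preimg X act g (c g)) ` (F \<rightarrow>\<^sub>E \<U>)"
    proof
      fix V assume "V \<in> cover_join X act \<U> F"
      then obtain c where c: "V = (\<Inter>g\<in>F. preimg X act g (c g))" "c \<in> F \<rightarrow> \<U>"
        by (auto simp: cover_join_def)
      then have "V = (\<Inter>g\<in>F. preimg X act g (restrict c F g))" "restrict c F \<in> F \<rightarrow>\<^sub>E \<U>" by auto
      then show "V \<in> (\<lambda>c. \<Inter>g\<in>F. preimg X act g (c g)) ` (F \<rightarrow>\<^sub>E \<U>)" by blast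
    qed
    moreover have "finite (F \<rightarrow>\<^sub>E \<U>)" using J by (intro finite_PiE) (auto simp: \<U>_def)
    ultimately show ?thesis by (meson finite_imageI finite_subset)
  qed
  \<comment> \<open>The join is a finite cover, hence a finite subcover of itself, so the minimum in
    \<open>min_subcover\<close> is attained.\<close>
  ultimately have "?P (card (cover_join X act \<U> F))" by blast
  then have "?P (min_subcover X (cover_join X act \<U> F))" unfolding min_subcover_def by (rule LeastI)
  then obtain \<V> where \<V>: "\<V> \<subseteq> cover_join X act \<U> F" "finite \<V>" "\<Union>\<V> = X"
    "card \<V> = min_subcover X (cover_join X act \<U> F)" by blast
  have "\<exists>V\<in>\<V>. \<exists>p\<in>V. \<forall>s\<in>J. act s p \<in> [C0, C1] ! \<phi> s" if "\<phi> \<in> J \<rightarrow>\<^sub>E {..<2::nat}" for \<phi>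
  proof -
    have "(\<Inter>s\<in>J. preimg X act s ([C0, C1] ! \<phi> s)) \<noteq> {}"
      using J(5)[unfolded independence_set_def] J(1) Jf that
      by (auto simp: PiE_def numeral_2_eq_2)
    then obtain p where p: "\<And>s. s \<in> J \<Longrightarrow> p \<in> X \<and> act s p \<in> [C0, C1] ! \<phi> s"
      by (auto simp: preimg_def)
    moreover have "p \<in> \<Union>\<V>" using p J \<V>(3) by blast
    ultimately show ?thesis by blast
  qed
  then obtain V where V: "\<And>\<phi>. \<phi> \<in> J \<rightarrow>\<^sub>E {..<2::nat} \<Longrightarrow>
      V \<phi> \<in> \<V> \<and> (\<exists>p\<in>V \<phi>. \<forall>s\<in>J. act s p \<in> [C0, C1] ! \<phi> s)" by metis
  have "inj_on V (J \<rightarrow>\<^sub>E {..<2})"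
  proof (rule inj_onI)
    fix \<phi> \<psi> assume \<phi>: "\<phi> \<in> J \<rightarrow>\<^sub>E {..<2::nat}" and \<psi>: "\<psi> \<in> J \<rightarrow>\<^sub>E {..<2}" and eq: "V \<phi> = V \<psi>"
    obtain p where p: "p \<in> V \<phi>" "\<And>s. s \<in> J \<Longrightarrow> act s p \<in> [C0, C1] ! \<phi> s" using V[OF \<phi>] by blast
    obtain p' where p': "p' \<in> V \<phi>" "\<And>s. s \<in> J \<Longrightarrow> act s p' \<in> [C0, C1] ! \<psi> s" using V[OF \<psi>] eq by auto
    obtain c where c: "c \<in> F \<rightarrow> \<U>" "V \<phi> = (\<Inter>g\<in>F. preimg X act g (c g))"
      using V[OF \<phi>] \<V>(1) unfolding cover_join_def by blast
    show "\<phi> = \<psi>"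
    proof (rule PiE_ext[OF \<phi> \<psi>])
      fix s assume s: "s \<in> J"
      have "s \<in> F" using s J by blast
      then have "c s \<in> \<U>" "act s p \<in> c s" "act s p' \<in> c s"
        using c p p' by (auto simp: preimg_def)
      moreover have "\<phi> s \<in> {..<2}" "\<psi> s \<in> {..<2}" using \<phi> \<psi> s by auto
      ultimately show "\<phi> s = \<psi> s"
        using p(2)[OF s] p'(2)[OF s] by (auto simp: \<U>_def less_2_cases_iff)
    qed
  qed
  then have "card (J \<rightarrow>\<^sub>E {..<2::nat}) \<le> card \<V>"
    by (rule card_inj_on_le) (use V \<V> in auto)
  then show ?thesis using \<V>(4) Jf by (simp add: card_PiE \<U>_def)
qed

text \<open>A single cover suffices: for every \<open>F\<close> at least \<open>2 ^ card J\<close>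
  sets are needed, where \<open>card J\<close> is at least \<open>q\<close> times
  \<open>card F\<close>, which gives the uniform lower bound \<open>q * ln 2\<close>.\<close>

lemma naive_entropy_pos:
  assumes xy: "[x, y] \<in> IE G X act 2" "x \<noteq> y"
  shows "naive_entropy G X act > 0"
proof -
  have X: "x \<in> X" "y \<in> X" using xy by (auto simp: IE_def power_space_def)
  \<comment> \<open>A third of the distance keeps the closed balls disjoint, so their complements
    cover \<open>X\<close>.\<close>
  define r where "r = dist x y / 3"
  have r: "r > 0" using xy by (simp add: r_def)
  define C0 where "C0 = X \<inter> cball x r"
  define C1 where "C1 = X \<inter> cball y r"
  define \<U> where "\<U> = {X - C0, X - C1}"
  have disj: "C0 \<inter> C1 = {}"
  proof -
    have False if "dist x z \<le> r" "dist y z \<le> r" for z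
      using that dist_triangle2[of x y z] r unfolding r_def by linarith
    then show ?thesis by (auto simp: C0_def C1_def)
  qed
  have "X - C0 = X \<inter> (- cball x r)" "X - C1 = X \<inter> (- cball y r)" by (auto simp: C0_def C1_def)
  then have "openin (top_of_set X) (X - C0)" "openin (top_of_set X) (X - C1)"
    by (metis openin_open_Int closed_cball open_Compl)+
  then have cover: "\<U> \<in> open_covers X" using disj by (auto simp: open_covers_def \<U>_def)
  define q where "q = independence_density G X act [C0, C1]"
  have int: "z \<in> top_of_set X interior_of (X \<inter> cball z r)" if "z \<in> X" for z
    unfolding interior_of_def using that r
    by (auto intro!: exI[of _ "X \<inter> ball z r"] openin_open_Int)
  have "q > 0"
  proof -
    have "\<forall>i<2. [C0, C1] ! i \<subseteq> X \<and> [x, y] ! i \<in> top_of_set X interior_of ([C0, C1] ! i)"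
      using int[OF X(1)] int[OF X(2)] by (auto simp: less_2_cases_iff C0_def C1_def)
    then show ?thesis using xy(1) unfolding IE_def q_def by auto
  qed
  have q: "density_bound G X act [C0, C1] q"
    unfolding q_def by (rule independence_density_greatest(1)) auto
  have bound: "q * ln 2 \<le> ln (real (min_subcover X (cover_join X act \<U> F))) / real (card F)"
    if F: "F \<noteq> {}" "finite F" "F \<subseteq> carrier G" for F
  proof -
    obtain J where J: "J \<subseteq> F" "real (card J) \<ge> q * real (card F)" "independence_set G X act [C0, C1] J"
      using q F unfolding density_bound_def by blast
    have Fpos: "real (card F) > 0" using F by (simp add: card_gt_0_iff)
    then have "J \<noteq> {}" using J(2) \<open>q > 0\<close> by (auto simp: mult_le_0_iff)
    then have "2 ^ card J \<le> min_subcover X (cover_join X act \<U> F)"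
      unfolding \<U>_def by (rule min_subcover_ge_independence[OF disj _ J(1) F(2,3) J(3)])
    then have "2 ^ card J \<le> real (min_subcover X (cover_join X act \<U> F))"
      by (metis of_nat_le_iff of_nat_numeral of_nat_power)
    then have "ln (2 ^ card J) \<le> ln (real (min_subcover X (cover_join X act \<U> F)))"
      by (intro ln_mono) (auto intro: less_le_trans[of _ "2 ^ card J"])
    then have "real (card J) * ln 2 \<le> ln (real (min_subcover X (cover_join X act \<U> F)))"
      by (simp add: ln_realpow)
    moreover have "q * real (card F) * ln 2 \<le> real (card J) * ln 2"
      using J(2) by (intro mult_right_mono) auto
    ultimately have "q * ln 2 * real (card F) \<le> ln (real (min_subcover X (cover_join X act \<U> F)))"
      by (simp only: mult_ac)
    then show ?thesis using Fpos by (simp only: pos_le_divide_eq)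
  qed
  have "0 < ereal (q * ln 2)" using \<open>q > 0\<close> by simp
  also have "\<dots> \<le> (INF F\<in>{F. F \<noteq> {} \<and> finite F \<and> F \<subseteq> carrier G}.
      ereal (ln (real (min_subcover X (cover_join X act \<U> F))) / real (card F)))"
    using bound by (intro INF_greatest) auto
  also have "\<dots> \<le> naive_entropy G X act"
    unfolding naive_entropy_def using cover by (rule SUP_upper)
  finally show ?thesis .
qed

text \<open>Neighbourhoods of a tuple are also neighbourhoods of a nearby asymptotic tuple, which
  lies in \<open>IE\<close> because its common partner \<open>w\<close> does at order 1.\<close>

lemma naive_UPE_if_asymptotic_dense:
  assumes exp: "expansive G X act" and tmp: "topological_markov G X act"
    and IE1: "IE G X act 1 = power_space X 1"
    and dense: "top_of_set (X \<times> X) closure_of asymptotic_pairs G X act = X \<times> X"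
  shows "naive_UPE_all_orders G X act"
proof -
  have "xs \<in> IE G X act k" if k: "k \<ge> 2" and xs: "xs \<in> power_space X k" for xs k
    unfolding IE_def
  proof (intro CollectI conjI allI impI xs)
    fix Us :: "'x set list"
    assume "length Us = k \<and>
      (\<forall>i<k. Us ! i \<subseteq> X \<and> xs ! i \<in> top_of_set X interior_of (Us ! i))"
    then have len: "length Us = k"
      and Us: "\<forall>i<k. Us ! i \<subseteq> X \<and> xs ! i \<in> top_of_set X interior_of (Us ! i)" by auto
    have lxs: "length xs = k" "set xs \<subseteq> X" using xs by (auto simp: power_space_def)
    have "X \<noteq> {}" using k lxs by fastforce
    \<comment> \<open>The balls are placed in the interiors, since the \<open>Us\<close> must remain
      neighbourhoods of the perturbed tuple.\<close>
    have "\<exists>r>0. \<forall>i\<in>{..<k}. X \<inter> ball (xs ! i) r \<subseteq> top_of_set X interior_of (Us ! i)"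
    proof (rule uniform_radius)
      fix i assume i: "i \<in> {..<k}"
      obtain O' where O': "open O'" "top_of_set X interior_of (Us ! i) = X \<inter> O'"
        using openin_interior_of[of "top_of_set X" "Us ! i"] unfolding openin_open by blast
      then obtain r where "r > 0" "ball (xs ! i) r \<subseteq> O'"
        using Us i by (metis IntD2 lessThan_iff open_contains_ball)
      then show "\<exists>r>0. X \<inter> ball (xs ! i) r \<subseteq> top_of_set X interior_of (Us ! i)"
        using O' by blast
    qed auto
    then obtain r where r: "r > 0"
      "\<And>i. i < k \<Longrightarrow> X \<inter> ball (xs ! i) r \<subseteq> top_of_set X interior_of (Us ! i)" by blast
    obtain w us where w: "w \<in> X"
      and us: "list_all2 (\<lambda>u x. (w, u) \<in> asymptotic_pairs G X act \<and> dist u x < r) us xs"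
      using asymptotic_tuples_dense[OF exp tmp dense \<open>X \<noteq> {}\<close> lxs(2) r(1)] by blast
    have us': "length us = k" "\<And>i. i < k \<Longrightarrow> (w, us ! i) \<in> asymptotic_pairs G X act"
      "\<And>i. i < k \<Longrightarrow> dist (us ! i) (xs ! i) < r"
      using us lxs by (auto simp: list_all2_conv_all_nth)
    have "[w] \<in> IE G X act 1" unfolding IE1 using w by (simp add: power_space_def)
    then have "us \<in> IE G X act k"
      using IE_if_asymptotic[OF exp tmp, of w us] us' by (metis in_set_conv_nth)
    moreover have "us ! i \<in> top_of_set X interior_of (Us ! i)" if i: "i < k" for i
      using r(2)[OF i] us'(2,3)[OF i] by (auto simp: asymptotic_pairs_def dist_commute)
    ultimately show "independence_density G X act Us > 0"
      using Us len unfolding IE_def by auto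
  qed
  then show ?thesis unfolding naive_UPE_all_orders_def IE_def by blast
qed

end

theorem corollary6p2:
  fixes G :: "('g, 'm) monoid_scheme"
    and X :: "'x::metric_space set"
    and act :: "'g \<Rightarrow> 'x \<Rightarrow> 'x"
  assumes "group G"
    and "countable (carrier G)" and "infinite (carrier G)"
    and "compact X"
    and "continuous_action G X act"
    and "expansive G X act"
    and "topological_markov G X act"
  shows "(\<forall>x y. (x, y) \<in> asymptotic_pairs G X act \<and> x \<noteq> y \<and> [x] \<in> IE G X act 1 \<longrightarrow>
            [x, y] \<in> IE G X act 2 \<and> naive_entropy G X act > 0) \<and>
         (IE G X act 1 = power_space X 1 \<and>
          top_of_set (X \<times> X) closure_of asymptotic_pairs G X act = X \<times> X \<longrightarrow>
            naive_UPE_all_orders G X act)"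
proof -
  interpret compact_action G X act by (rule compact_action.intro) (use assms in auto)
  have "[x, y] \<in> IE G X act 2"
    if xy: "(x, y) \<in> asymptotic_pairs G X act" and x: "[x] \<in> IE G X act 1" for x y
  proof -
    \<comment> \<open>Both entries of the pair have to be asymptotic to \<open>x\<close>; the first
      one is \<open>x\<close> itself.\<close>
    have "(x, x) \<in> asymptotic_pairs G X act" using xy by (auto simp: asymptotic_pairs_def)
    then show ?thesis
      using IE_if_asymptotic[OF assms(6,7) x, of "[x, y]"] xy by (auto simp: numeral_2_eq_2)
  qed
  then show ?thesis
    using naive_entropy_pos naive_UPE_if_asymptotic_dense[OF assms(6,7)] by blast
qed

end
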